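(* Let $P$ be an isonemal prefabric of order greater than $4$ whose symmetry group is of type $p4$ (that is, its planar symmetry group $G_1$ is of crystallographic type $p4$). Then $G_1$ must have a lattice unit that is of level $1$ or of a higher level (based on a level-$1$ unit), or that is the reflection in a forbidden line of a lattice unit of level $1$ or of a higher level.
   Context: The plane $E$ is tessellated by unit squares called cells, with horizontal and vertical sides. The strands are the vertical columns of cells (warps) and the horizontal rows of cells (wefts). A prefabric assigns to each cell which of the two strands crossing there is uppermost. A symmetry is a pair $(g,\epsilon)$, where $g$ is an isometry of $E$ mapping the tessellation by cells to itself and $\epsilon\in\{e,\tau\}$: if $\epsilon=e$, $g$ carries the uppermost strand at each cell $c$ to the uppermost strand at $g(c)$; if $\epsilon=\tau$ (reversal of the two sides of $E$), $g$ carries the uppermost strand at $c$ to the lowermost strand at $g(c)$. The symmetries form the group $G$; $G_1$ is the planar group of all $g$ occurring in elements of $G$. The prefabric is isonemal if $G$ is transitive on the strands. Its order is the least positive integer $n$ such that the over-under sequence along the strands repeats every $n$ cells. For a group of type $p4$ (two independent translations, quarter-turns, no reflections or glide-reflections), a lattice unit is a square whose side vectors generate the translation subgroup and whose corners are centres of quarter-turns of the group (its centre is then also a centre of quarter-turns, and the mid-points of its sides are centres of half-turns). Lattice units are not unique. Levels. A level-$1$ lattice unit is a square with side vectors $(M_1,N_1)$ and $(-N_1,M_1)$, where $M_1>N_1>0$ are integers of opposite parity, and with corners all at cell corners or all at cell centres. A square $Q'$ escribes a square $Q$ if the corners of $Q$ are the mid-points of the sides of $Q'$. A lattice unit of level $n+1$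 is the square escribing a lattice unit of level $n$; so a unit of level $n+1$ is based on a level-$1$ unit with the same centre and has $2^n$ times its area. The forbidden lines, with origin at the centre of the unit, are $x=0$, $y=0$, $y=x$ and $y=-x$. *)

theory Defs
  imports "HOL-Analysis.Analysis"
begin

text \<open>The plane is the type \<^typ>\<open>complex\<close>, so that the vector \<open>(a, b)\<close> is \<open>Complex a b\<close> and
  multiplication by \<open>\<i>\<close> is the quarter-turn about the origin.\<close>

section \<open>Prefabrics and their symmetries\<close>

definition cell :: "int \<Rightarrow> int \<Rightarrow> complex set" where
  "cell i j = cbox (Complex (of_int i) (of_int j)) (Complex (of_int i + 1) (of_int j + 1))"

definition cells :: "complex set set" where
  "cells = {cell i j | i j. True}"

definition warp :: "int \<Rightarrow> complex set" where
  "warp i = (\<Union>j. cell i j)"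

definition weft :: "int \<Rightarrow> complex set" where
  "weft j = (\<Union>i. cell i j)"

definition strands :: "complex set set" where
  "strands = range warp \<union> range weft"

text \<open>\<open>P i j\<close> means that the warp is uppermost at \<open>cell i j\<close>.\<close>

type_synonym prefabric = "int \<Rightarrow> int \<Rightarrow> bool"

definition uppermost :: "prefabric \<Rightarrow> int \<Rightarrow> int \<Rightarrow> complex set" where
  "uppermost P i j = (if P i j then warp i else weft j)"

definition lowermost :: "prefabric \<Rightarrow> int \<Rightarrow> int \<Rightarrow> complex set" where
  "lowermost P i j = (if P i j then weft j else warp i)"

definition plane_isometry :: "(complex \<Rightarrow> complex) \<Rightarrow> bool" where
  "plane_isometry g \<longleftrightarrow> bij g \<and> (\<forall>x y. dist (g x) (g y) = dist x y)"

definition preserves_tessellation :: "(complex \<Rightarrow> complex) \<Rightarrow> bool" where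
  "preserves_tessellation g \<longleftrightarrow> (\<lambda>c. g ` c) ` cells = cells"

text \<open>\<open>Keep\<close> is \<open>e\<close> and \<open>Reverse\<close> is \<open>\<tau>\<close>.\<close>

datatype side_action = Keep | Reverse

definition symmetry :: "prefabric \<Rightarrow> (complex \<Rightarrow> complex) \<Rightarrow> side_action \<Rightarrow> bool" where
  "symmetry P g \<epsilon> \<longleftrightarrow>
     plane_isometry g \<and> preserves_tessellation g \<and>
     (\<forall>i j k l. g ` cell i j = cell k l \<longrightarrow>
        g ` uppermost P i j =
          (case \<epsilon> of Keep \<Rightarrow> uppermost P k l | Reverse \<Rightarrow> lowermost P k l))"

definition symmetry_group :: "prefabric \<Rightarrow> ((complex \<Rightarrow> complex) \<times> side_action) set" where
  "symmetry_group P = {(g, \<epsilon>). symmetry P g \<epsilon>}"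

definition planar_group :: "prefabric \<Rightarrow> (complex \<Rightarrow> complex) set" where
  "planar_group P = fst ` symmetry_group P"

definition isonemal :: "prefabric \<Rightarrow> bool" where
  "isonemal P \<longleftrightarrow>
     (\<forall>s\<in>strands. \<forall>t\<in>strands. \<exists>(g, \<epsilon>)\<in>symmetry_group P. g ` s = t)"

definition repeats_every :: "prefabric \<Rightarrow> nat \<Rightarrow> bool" where
  "repeats_every P n \<longleftrightarrow>
     (\<forall>i j. P i (j + int n) = P i j) \<and> (\<forall>i j. P (i + int n) j = P i j)"

text \<open>Meaningful only if some positive period exists, as is the case whenever the planar group
  contains two independent translations.\<close>

definition prefabric_order :: "prefabric \<Rightarrow> nat" where
  "prefabric_order P = (LEAST n. 0 < n \<and> repeats_every P n)"

section \<open>Groups of type p4\<close>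

definition translation_vectors :: "(complex \<Rightarrow> complex) set \<Rightarrow> complex set" where
  "translation_vectors H = {v. (\<lambda>z. z + v) \<in> H}"

text \<open>Centres of anticlockwise quarter-turns; in a group the clockwise ones have the same
  centres.\<close>

definition quarter_turn_centres :: "(complex \<Rightarrow> complex) set \<Rightarrow> complex set" where
  "quarter_turn_centres H = {c. (\<lambda>z. c + \<i> * (z - c)) \<in> H}"

text \<open>Reflection in the line through \<open>p\<close> with direction \<open>u \<noteq> 0\<close>.\<close>

definition reflection :: "complex \<Rightarrow> complex \<Rightarrow> complex \<Rightarrow> complex" where
  "reflection p u z = p + u * cnj ((z - p) / u)"

text \<open>Reflection followed by translation along its axis; a reflection if \<open>t = 0\<close>.\<close>

definition glide_reflection :: "complex \<Rightarrow> complex \<Rightarrow> real \<Rightarrow> complex \<Rightarrow> complex" where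
  "glide_reflection p u t z = reflection p u z + of_real t * u"

text \<open>To be applied to groups \<open>H\<close> of isometries that preserve the tessellation by cells.
  These are discrete, and their rotations have order dividing 4, so neither property
  needs to be required here.\<close>

definition type_p4 :: "(complex \<Rightarrow> complex) set \<Rightarrow> bool" where
  "type_p4 H \<longleftrightarrow>
     (\<exists>u\<in>translation_vectors H. \<exists>v\<in>translation_vectors H. u \<noteq> v \<and> independent {u, v}) \<and>
     quarter_turn_centres H \<noteq> {} \<and>
     (\<forall>p u t. u \<noteq> 0 \<longrightarrow> reflection p u \<notin> H \<and> glide_reflection p u t \<notin> H)"

section \<open>Squares, lattice units and levels\<close>

text \<open>A square is represented by the set of its four corners. The same square arises from
  each of its corners \<open>p\<close>, with the side vectors \<open>w\<close> and \<open>\<i> * w\<close> starting there.\<close>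

definition square :: "complex \<Rightarrow> complex \<Rightarrow> complex set" where
  "square p w = {p, p + w, p + w + \<i> * w, p + \<i> * w}"

definition square_centre :: "complex set \<Rightarrow> complex" where
  "square_centre Q = (\<Sum>z\<in>Q. z) / 4"

definition lattice_unit :: "(complex \<Rightarrow> complex) set \<Rightarrow> complex set \<Rightarrow> bool" where
  "lattice_unit H Q \<longleftrightarrow>
     (\<exists>p w. w \<noteq> 0 \<and> Q = square p w \<and>
        translation_vectors H = {of_int a * w + of_int b * (\<i> * w) | a b. True} \<and>
        Q \<subseteq> quarter_turn_centres H)"

definition escribes :: "complex set \<Rightarrow> complex set \<Rightarrow> bool" where
  "escribes Q' Q \<longleftrightarrow>
     (\<exists>p w. w \<noteq> 0 \<and> Q' = square p w \<and>
        Q = {midpoint p (p + w),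
             midpoint (p + w) (p + w + \<i> * w),
             midpoint (p + w + \<i> * w) (p + \<i> * w),
             midpoint (p + \<i> * w) p})"

definition cell_corners :: "complex set" where
  "cell_corners = {Complex (of_int i) (of_int j) | i j. True}"

definition cell_centres :: "complex set" where
  "cell_centres = {Complex (of_int i + 1 / 2) (of_int j + 1 / 2) | i j. True}"

inductive unit_of_level :: "nat \<Rightarrow> complex set \<Rightarrow> bool" where
  level_one:
    "\<lbrakk>M > N; N > 0; odd (M + N); Q = square p (Complex (of_int M) (of_int N));
      Q \<subseteq> cell_corners \<or> Q \<subseteq> cell_centres\<rbrakk> \<Longrightarrow> unit_of_level 1 Q"
    for M N :: int
| level_Suc:
    "\<lbrakk>unit_of_level n Q; escribes Q' Q\<rbrakk> \<Longrightarrow> unit_of_level (Suc n) Q'"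

text \<open>Directions of the forbidden lines \<open>y = 0\<close>, \<open>x = 0\<close>, \<open>y = x\<close> and \<open>y = -x\<close>.\<close>

definition forbidden_directions :: "complex set" where
  "forbidden_directions = {1, \<i>, 1 + \<i>, 1 - \<i>}"

definition forbidden_reflection :: "complex set \<Rightarrow> complex set \<Rightarrow> bool" where
  "forbidden_reflection Q Q' \<longleftrightarrow>
     (\<exists>u\<in>forbidden_directions. Q = reflection (square_centre Q') u ` Q')"

end

theory Submission
  imports Defs
begin

text \<open>
  The plane is the complex plane, and the statement is about divisibility of Gaussian integers.
  In type \<open>p4\<close> every element of \<open>G\<^sub>1\<close> has the form \<open>z \<mapsto> u * z + c\<close> with \<open>u\<close> a unit and \<open>c\<close>
  an element of the ring of Gaussian integers (\<open>planar_group_cell_rotation\<close>). The translation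
  vectors form a nonzero ideal, closed under multiplication by \<open>\<i>\<close> because quarter-turns
  conjugate translations, and so they are the multiples of a single Gaussian integer \<open>w\<close>
  (\<open>translation_lattice\<close>). Any square with side vectors \<open>w\<close> and \<open>\<i> * w\<close> that starts at a centre
  of quarter-turns is a lattice unit.

  Splitting off all factors \<open>1 + \<i>\<close> and choosing the generator suitably among its associates,
  \<open>w = (1 + \<i>) ^ n * (M + N * \<i>)\<close> with \<open>M > 0\<close>, \<open>N \<ge> 0\<close> and \<open>M + N\<close> odd. Passing to the
  escribing square multiplies half-diagonals by \<open>1 + \<i>\<close> and keeps the centre, so if \<open>M > N > 0\<close>
  this unit has level \<open>n + 1\<close> (\<open>unit_of_level_centred_square\<close>), and if \<open>N > M\<close> its reflection in
  the horizontal line through the centre has that level.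

  Only \<open>N = 0\<close> remains, and there the other two hypotheses enter
  (\<open>generator_not_axis_parallel\<close>). An integer \<open>d\<close> that divides all translation vectors has
  absolute value at most \<open>2\<close>: translations move warps by multiples of \<open>d\<close>, half-turns add at most
  one residue class, and isonemality demands that every warp be reached (\<open>divisor_le_2\<close>). As \<open>M\<close>
  is odd this gives \<open>M = 1\<close>, and as \<open>4\<close> divides \<open>(1 + \<i>) ^ 4\<close> it gives \<open>n \<le> 3\<close>. Conversely,
  \<open>(1 + \<i>) * v\<close> is a translation that keeps the sides for every translation vector \<open>v\<close>, since
  \<open>v\<close> and \<open>\<i> * v\<close> have equal side actions. For \<open>n \<le> 3\<close> this covers \<open>4 = - (1 + \<i>) ^ 4\<close>, and
  the order is at most \<open>4\<close> (\<open>order_le_4\<close>).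
\<close>

section \<open>Gaussian integers\<close>

definition gauss_units :: "complex set" where
  "gauss_units = {1, \<i>, - 1, - \<i>}"

lemma cell_corners_iff: "z \<in> cell_corners \<longleftrightarrow> Re z \<in> \<int> \<and> Im z \<in> \<int>"
proof
  assume "z \<in> cell_corners"
  then show "Re z \<in> \<int> \<and> Im z \<in> \<int>" by (auto simp: cell_corners_def)
next
  assume "Re z \<in> \<int> \<and> Im z \<in> \<int>"
  then obtain a b :: int where "Re z = of_int a" "Im z = of_int b" by (auto elim!: Ints_cases)
  then show "z \<in> cell_corners"
    unfolding cell_corners_def by (auto simp: complex_eq_iff)
qed

lemma cell_corners_add: "x \<in> cell_corners \<Longrightarrow> y \<in> cell_corners \<Longrightarrow> x + y \<in> cell_corners"
  and cell_corners_diff: "x \<in> cell_corners \<Longrightarrow> y \<in> cell_corners \<Longrightarrow> x - y \<in> cell_corners"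
  and cell_corners_minus: "x \<in> cell_corners \<Longrightarrow> - x \<in> cell_corners"
  and cell_corners_mult: "x \<in> cell_corners \<Longrightarrow> y \<in> cell_corners \<Longrightarrow> x * y \<in> cell_corners"
  by (auto simp: cell_corners_iff)

lemma gauss_units_corners: "u \<in> gauss_units \<Longrightarrow> u \<in> cell_corners"
  by (auto simp: gauss_units_def cell_corners_iff)

lemma gauss_units_inverse: "u \<in> gauss_units \<Longrightarrow> \<exists>u'\<in>gauss_units. u * u' = 1 \<and> u' * u = 1"
  by (auto simp: gauss_units_def)

lemma gauss_units_mult: "u \<in> gauss_units \<Longrightarrow> v \<in> gauss_units \<Longrightarrow> u * v \<in> gauss_units"
  by (auto simp: gauss_units_def)

lemma gauss_units_power: "u \<in> gauss_units \<Longrightarrow> u ^ n \<in> gauss_units"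
  by (induction n) (auto intro: gauss_units_mult simp: gauss_units_def)

text \<open>Cell corners and cell centres together are the multiples of \<open>1 / (1 - \<i>)\<close> by Gaussian integers.
  This is where the centres of quarter-turns lie, since \<open>z \<mapsto> \<i> * z + b\<close> has centre
  \<open>b / (1 - \<i>)\<close>.\<close>

lemma corners_or_centres_iff:
  "z \<in> cell_corners \<or> z \<in> cell_centres \<longleftrightarrow> (1 - \<i>) * z \<in> cell_corners"
proof
  assume "z \<in> cell_corners \<or> z \<in> cell_centres"
  then show "(1 - \<i>) * z \<in> cell_corners"
  proof
    assume "z \<in> cell_corners"
    then show ?thesis by (intro cell_corners_mult) (simp_all add: cell_corners_iff)
  next
    assume "z \<in> cell_centres"
    then obtain i j :: int where z: "z = Complex (of_int i + 1/2) (of_int j + 1/2)"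
      by (auto simp: cell_centres_def)
    have "(1 - \<i>) * z = Complex (of_int (i + j + 1)) (of_int (j - i))"
      by (simp add: z complex_eq_iff)
    then show ?thesis unfolding cell_corners_def by blast
  qed
next
  assume "(1 - \<i>) * z \<in> cell_corners"
  then obtain a b :: int where "(1 - \<i>) * z = Complex (of_int a) (of_int b)"
    by (auto simp: cell_corners_def)
  then have ab: "Re z + Im z = of_int a" "Im z - Re z = of_int b"
    by (auto simp: complex_eq_iff)
  show "z \<in> cell_corners \<or> z \<in> cell_centres"
  proof (cases "even (a - b)")
    case True
    then obtain k where "a - b = 2 * k" by (rule evenE)
    then have "b = a - 2 * k" by simp
    with ab have "z = Complex (of_int k) (of_int (a - k))" by (auto simp: complex_eq_iff)
    then show ?thesis unfolding cell_corners_def by blast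
  next
    case False
    then obtain k where "a - b = 2 * k + 1" by (rule oddE)
    then have "b = a - 2 * k - 1" by simp
    with ab have "z = Complex (of_int k + 1/2) (of_int (a - k - 1) + 1/2)"
      by (auto simp: complex_eq_iff)
    then show ?thesis unfolding cell_centres_def by blast
  qed
qed

lemma cell_centres_add_corner:
  assumes "z \<in> cell_centres" "v \<in> cell_corners" shows "z + v \<in> cell_centres"
proof -
  obtain i j a b :: int where "z = Complex (of_int i + 1/2) (of_int j + 1/2)"
      "v = Complex (of_int a) (of_int b)"
    using assms by (auto simp: cell_corners_def cell_centres_def)
  then have "z + v = Complex (of_int (i + a) + 1/2) (of_int (j + b) + 1/2)"
    by (simp add: complex_eq_iff)
  then show ?thesis unfolding cell_centres_def by blast
qed

text \<open>Division with remainder: rounding \<open>v / w\<close> to a nearest Gaussian integer leaves a remainder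
  shorter than \<open>w\<close>, because the error is at most half a unit in each coordinate. So a nonzero
  element of least length generates.\<close>

lemma gauss_ideal_principal:
  assumes sub: "L \<subseteq> cell_corners"
    and diff: "\<And>v w. v \<in> L \<Longrightarrow> w \<in> L \<Longrightarrow> v - w \<in> L"
    and rot: "\<And>v. v \<in> L \<Longrightarrow> \<i> * v \<in> L"
    and nonzero: "\<exists>v\<in>L. v \<noteq> 0"
  shows "\<exists>w. w \<noteq> 0 \<and> L = {q * w | q. q \<in> cell_corners}"
proof -
  have zero: "0 \<in> L" using nonzero diff by (metis diff_self)
  have minus: "- v \<in> L" if "v \<in> L" for v using diff[OF zero that] by simp
  have add: "v + w \<in> L" if "v \<in> L" "w \<in> L" for v w
    using diff[OF that(1) minus[OF that(2)]] by simp
  have nat_mult: "of_nat n * v \<in> L" if "v \<in> L" for n v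
    by (induction n) (use zero add that in \<open>auto simp: algebra_simps\<close>)
  have int_mult: "of_int a * v \<in> L" if "v \<in> L" for a v
  proof (cases a)
    case (nonneg n) then show ?thesis using nat_mult[OF that] by simp
  next
    case (neg n)
    then have "of_int a = - (of_nat (Suc n) :: complex)"
      by (simp only: of_int_minus of_int_of_nat_eq)
    then have "of_int a * v = - (of_nat (Suc n) * v)" by (simp only: mult_minus_left)
    then show ?thesis using nat_mult[OF that] minus by metis
  qed
  have mult: "q * v \<in> L" if q: "q \<in> cell_corners" and v: "v \<in> L" for q v
  proof -
    obtain a b :: int where "q = Complex (of_int a) (of_int b)"
      using q by (auto simp: cell_corners_def)
    then have "q * v = of_int a * v + of_int b * (\<i> * v)"
      by (simp add: complex_eq_iff algebra_simps)
    then show ?thesis using add int_mult rot v by simp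
  qed
  \<comment> \<open>the squared norms of Gaussian integers are natural numbers, so a least one exists\<close>
  define N where "N v = nat \<lfloor>(cmod v)\<^sup>2\<rfloor>" for v
  have N: "of_nat (N v) = (cmod v)\<^sup>2" if "v \<in> L" for v
  proof -
    have "v \<in> cell_corners" using that sub by blast
    then obtain a b :: int where v: "v = Complex (of_int a) (of_int b)"
      by (auto simp: cell_corners_def)
    have e: "(cmod v)\<^sup>2 = of_int (a\<^sup>2 + b\<^sup>2)" by (simp add: v cmod_power2)
    then have "\<lfloor>(cmod v)\<^sup>2\<rfloor> = a\<^sup>2 + b\<^sup>2" by (metis floor_of_int)
    then show ?thesis by (simp add: N_def e)
  qed
  obtain w where w: "w \<in> L" "w \<noteq> 0" and least: "\<And>v. v \<in> L \<Longrightarrow> v \<noteq> 0 \<Longrightarrow> N w \<le> N v"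
    using nonzero ex_has_least_nat[of "\<lambda>v. v \<in> L \<and> v \<noteq> 0" _ N] by blast
  have "v \<in> {q * w | q. q \<in> cell_corners}" if v: "v \<in> L" for v
  proof -
    define x where "x = v / w"
    define q where "q = Complex (of_int (round (Re x))) (of_int (round (Im x)))"
    have q: "q \<in> cell_corners" by (auto simp: q_def cell_corners_def)
    have r: "\<bar>Re (x - q)\<bar> \<le> 1/2" "\<bar>Im (x - q)\<bar> \<le> 1/2"
      using of_int_round_abs_le[of "Re x"] of_int_round_abs_le[of "Im x"]
      by (auto simp: q_def abs_minus_commute)
    have "(cmod (x - q))\<^sup>2 \<le> (1/2)\<^sup>2 + (1/2)\<^sup>2"
      unfolding cmod_power2 using r by (intro add_mono) (metis power2_abs abs_ge_zero power_mono)+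
    then have small: "(cmod (x - q))\<^sup>2 < 1" by (simp add: power2_eq_square)
    have e: "v - q * w = (x - q) * w" using w by (simp add: x_def field_simps)
    have mem: "v - q * w \<in> L" using v w q mult diff by blast
    have "v - q * w = 0"
    proof (rule ccontr)
      assume "v - q * w \<noteq> 0"
      then have "(cmod w)\<^sup>2 \<le> (cmod (v - q * w))\<^sup>2"
        using least[OF mem] N[OF mem] N[OF w(1)] by (metis of_nat_le_iff)
      moreover have "(cmod (v - q * w))\<^sup>2 = (cmod (x - q))\<^sup>2 * (cmod w)\<^sup>2"
        by (simp add: e norm_mult power_mult_distrib)
      moreover have "(cmod (x - q))\<^sup>2 * (cmod w)\<^sup>2 < 1 * (cmod w)\<^sup>2"
        using small w by (intro mult_strict_right_mono) auto
      ultimately show False by simp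
    qed
    then show ?thesis using q by auto
  qed
  moreover have "q * w \<in> L" if "q \<in> cell_corners" for q using mult that w by blast
  ultimately show ?thesis using w by blast
qed

text \<open>If \<open>a\<close> and \<open>b\<close> have the same parity, \<open>a + b * \<i>\<close> is divisible by \<open>1 + \<i>\<close>, and the quotient has
  half the squared norm. The exponent reached in the end is the level of the lattice unit,
  less one.\<close>

lemma gauss_factor_one_plus_i:
  assumes "w \<in> cell_corners" "w \<noteq> 0"
  shows "\<exists>n. \<exists>M N :: int. odd (M + N) \<and> w = (1 + \<i>) ^ n * Complex (of_int M) (of_int N)"
proof -
  have "\<exists>n. \<exists>M N :: int. odd (M + N) \<and>
      Complex (of_int a) (of_int b) = (1 + \<i>) ^ n * Complex (of_int M) (of_int N)"
    if "a \<noteq> 0 \<or> b \<noteq> 0" for a b :: int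
    using that
  proof (induction "nat (a\<^sup>2 + b\<^sup>2)" arbitrary: a b rule: less_induct)
    case less
    show ?case
    proof (cases "odd (a + b)")
      case True
      then show ?thesis by (intro exI[of _ 0] exI[of _ a] exI[of _ b]) simp
    next
      case False
      then obtain k where "a + b = 2 * k" unfolding not_not by (rule evenE)
      then have b: "b = 2 * k - a" by simp
      have e: "Complex (of_int a) (of_int b) = (1 + \<i>) * Complex (of_int k) (of_int (k - a))"
        by (simp add: complex_eq_iff b)
      have nz: "k \<noteq> 0 \<or> k - a \<noteq> 0" using less.prems b by auto
      then have "0 < k\<^sup>2 + (k - a)\<^sup>2" by (metis sum_power2_gt_zero_iff)
      moreover have "a\<^sup>2 + b\<^sup>2 = 2 * (k\<^sup>2 + (k - a)\<^sup>2)"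
        by (simp add: b power2_eq_square algebra_simps)
      ultimately have "nat (k\<^sup>2 + (k - a)\<^sup>2) < nat (a\<^sup>2 + b\<^sup>2)" by simp
      from less.hyps[OF this nz] obtain n M N where "odd (M + N)"
        "Complex (of_int k) (of_int (k - a)) = (1 + \<i>) ^ n * Complex (of_int M) (of_int N)"
        by blast
      then show ?thesis using e by (intro exI[of _ "Suc n"] exI[of _ M] exI[of _ N]) simp
    qed
  qed
  then show ?thesis using assms by (auto simp: cell_corners_def complex_eq_iff)
qed

lemma gauss_unit_first_quadrant:
  fixes M N :: int
  assumes "M \<noteq> 0 \<or> N \<noteq> 0"
  shows "\<exists>u\<in>gauss_units. \<exists>M' N' :: int. M' > 0 \<and> N' \<ge> 0 \<and> (odd (M' + N') \<longleftrightarrow> odd (M + N)) \<and>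
    u * Complex (of_int M) (of_int N) = Complex (of_int M') (of_int N')"
proof -
  consider "M > 0" "N \<ge> 0" | "N > 0" "M \<le> 0" | "M < 0" "N \<le> 0" | "N < 0" "M \<ge> 0"
    using assms by linarith
  then show ?thesis
  proof cases
    case 1
    then show ?thesis by (intro bexI[of _ 1] exI[of _ M] exI[of _ N]) (auto simp: gauss_units_def)
  next
    case 2
    then show ?thesis
      by (intro bexI[of _ "- \<i>"] exI[of _ N] exI[of _ "- M"])
        (auto simp: gauss_units_def complex_eq_iff)
  next
    case 3
    then show ?thesis
      by (intro bexI[of _ "- 1"] exI[of _ "- M"] exI[of _ "- N"])
        (auto simp: gauss_units_def complex_eq_iff)
  next
    case 4
    then show ?thesis
      by (intro bexI[of _ "\<i>"] exI[of _ "- N"] exI[of _ M])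
        (auto simp: gauss_units_def complex_eq_iff)
  qed
qed

section \<open>Squares\<close>

text \<open>The vector \<open>h\<close> is half a diagonal. Escribing squares and reflections in lines through the
  centre keep the centre fixed, so they act on \<open>h\<close> alone.\<close>

definition centred_square :: "complex \<Rightarrow> complex \<Rightarrow> complex set" where
  "centred_square c h = {c + h, c + \<i> * h, c - h, c - \<i> * h}"

lemma square_eq_centred_square:
  "square p w = centred_square (p + (1 + \<i>) / 2 * w) ((1 + \<i>) / 2 * w)"
  unfolding square_def centred_square_def by (auto simp: complex_eq_iff field_simps)

lemma centred_square_unit:
  assumes "u \<in> gauss_units" shows "centred_square c (u * h) = centred_square c h"
  using assms by (auto simp: gauss_units_def centred_square_def)

lemma square_centre_centred_square:
  assumes "h \<noteq> 0" shows "square_centre (centred_square c h) = c"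
proof -
  have "distinct [c + h, c + \<i> * h, c - h, c - \<i> * h]"
    using assms by (auto simp: complex_eq_iff)
  then have "(\<Sum>z\<in>centred_square c h. z) = (c + h) + (c + \<i> * h) + (c - h) + (c - \<i> * h)"
    by (simp add: centred_square_def)
  then show ?thesis by (simp add: square_centre_def)
qed

text \<open>The corners of the escribing square are the reflections of the centre in the sides, so its
  half-diagonals are sums of two adjacent half-diagonals of the given square.\<close>

lemma unit_of_level_escribed:
  assumes "unit_of_level n (centred_square c h)" "h \<noteq> 0"
  shows "unit_of_level (Suc n) (centred_square c ((1 + \<i>) * h))"
proof (rule level_Suc[OF assms(1)])
  define p where "p = c - (1 + \<i>) * h"
  define w where "w = 2 * h"
  have "square p w = centred_square c ((1 + \<i>) * h)"
    by (simp add: square_eq_centred_square p_def w_def)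
  moreover have "centred_square c h = {midpoint p (p + w), midpoint (p + w) (p + w + \<i> * w),
      midpoint (p + w + \<i> * w) (p + \<i> * w), midpoint (p + \<i> * w) p}"
    by (auto simp: midpoint_def p_def w_def centred_square_def complex_eq_iff field_simps)
  moreover have "w \<noteq> 0" using assms by (simp add: w_def)
  ultimately show "escribes (centred_square c ((1 + \<i>) * h)) (centred_square c h)"
    unfolding escribes_def by metis
qed

text \<open>The corners of the level-1 square based at \<open>c\<close> differ from \<open>c\<close> by multiples of
  \<open>1 / (1 - \<i>)\<close>, hence are cell corners or cell centres whenever \<open>c\<close> is one, and all of the same
  kind because the sides are Gaussian integers.\<close>

lemma unit_of_level_centred_square:
  fixes M N :: int
  assumes "M > N" "N > 0" "odd (M + N)"
    and c: "(1 - \<i>) * c \<in> cell_corners"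
    and w: "w = Complex (of_int M) (of_int N)"
  shows "unit_of_level (Suc n) (centred_square c ((1 + \<i>) ^ n * ((1 + \<i>) / 2 * w)))"
proof (induction n)
  case 0
  define p where "p = c - (1 + \<i>) / 2 * w"
  have sq: "square p w = centred_square c ((1 + \<i>) / 2 * w)"
    by (simp add: square_eq_centred_square p_def)
  have wc: "w \<in> cell_corners" by (auto simp: w cell_corners_def)
  have iw: "\<i> * w \<in> cell_corners" using wc by (auto simp: cell_corners_iff)
  have "(1 - \<i>) * p = (1 - \<i>) * c - w"
    by (simp add: p_def complex_eq_iff field_simps)
  then have "p \<in> cell_corners \<or> p \<in> cell_centres"
    using cell_corners_diff[OF c wc] by (simp add: corners_or_centres_iff)
  then have "square p w \<subseteq> cell_corners \<or> square p w \<subseteq> cell_centres"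
    using wc iw by (auto simp: square_def intro: cell_corners_add cell_centres_add_corner)
  then have "unit_of_level 1 (square p w)"
    using assms by (intro level_one[of N M]) auto
  then show ?case using sq by simp
next
  case (Suc n)
  have "w \<noteq> 0" using assms by (auto simp: complex_eq_iff)
  moreover have "(1 + \<i>) \<noteq> 0" by (simp add: complex_eq_iff)
  ultimately have "(1 + \<i>) ^ n * ((1 + \<i>) / 2 * w) \<noteq> 0" by simp
  from unit_of_level_escribed[OF Suc this] show ?case by (simp add: mult.assoc)
qed

lemma reflection_centred_square:
  "reflection c 1 ` centred_square c h = centred_square c (cnj h)"
  by (auto simp: reflection_def centred_square_def)

text \<open>Since \<open>1 - \<i>\<close> is a unit times \<open>1 + \<i>\<close>, conjugation preserves the level and only exchanges
  the coordinates of the odd part, up to a unit.\<close>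

lemma cnj_half_diagonal:
  "\<exists>u\<in>gauss_units. cnj ((1 + \<i>) ^ n * ((1 + \<i>) / 2 * Complex a b)) =
     u * ((1 + \<i>) ^ n * ((1 + \<i>) / 2 * Complex b a))"
proof -
  have 1: "cnj (1 + \<i>) = - \<i> * (1 + \<i>)" by (simp add: complex_eq_iff)
  have 2: "cnj ((1 + \<i>) / 2 * Complex a b) = (- 1) * ((1 + \<i>) / 2 * Complex b a)"
    by (simp add: complex_eq_iff field_simps)
  have "cnj ((1 + \<i>) ^ n * ((1 + \<i>) / 2 * Complex a b)) =
      ((- \<i>) ^ n * (- 1)) * ((1 + \<i>) ^ n * ((1 + \<i>) / 2 * Complex b a))"
    unfolding complex_cnj_mult[of "(1 + \<i>) ^ n"] complex_cnj_power 1 2 power_mult_distrib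
    by (simp add: mult_ac)
  moreover have "(- \<i>) ^ n * (- 1) \<in> gauss_units"
    by (intro gauss_units_mult gauss_units_power) (auto simp: gauss_units_def)
  ultimately show ?thesis by blast
qed


section \<open>The planar group as a group of rotations\<close>

text \<open>An isometry fixing the origin is real-linear and preserves inner products, so it sends
  \<open>1\<close> to a unit vector \<open>u\<close> and \<open>\<i>\<close> to one of \<open>\<i> * u\<close>, \<open>- \<i> * u\<close>.\<close>

lemma plane_isometry_cases:
  assumes "plane_isometry g"
  obtains u c where "norm u = 1" "g = (\<lambda>z. u * z + c)"
    | u c where "norm u = 1" "g = (\<lambda>z. u * cnj z + c)"
proof -
  define f where "f z = g z - g 0" for z
  have "orthogonal_transformation f"
    using assms unfolding orthogonal_transformation_isometry plane_isometry_def f_def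
    by (simp add: dist_norm)
  then have lin: "linear f" and inner: "\<And>v w. f v \<bullet> f w = v \<bullet> w"
    unfolding orthogonal_transformation_def by blast+
  define u where "u = f 1"
  have u: "Re u * Re u + Im u * Im u = 1" using inner[of 1 1] by (simp add: u_def inner_complex_def)
  have i: "Re (f \<i>) * Re (f \<i>) + Im (f \<i>) * Im (f \<i>) = 1"
    using inner[of \<i> \<i>] by (simp add: inner_complex_def)
  have p: "Re u * Re (f \<i>) + Im u * Im (f \<i>) = 0"
    using inner[of 1 \<i>] by (simp add: u_def inner_complex_def)
  define t where "t = Re u * Im (f \<i>) - Im u * Re (f \<i>)"
  have re: "Re (f \<i>) = - t * Im u" and im: "Im (f \<i>) = t * Re u"
    using u p unfolding t_def by algebra+
  have "t * t = 1" using i u unfolding re im by algebra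
  then have t: "t = 1 \<or> t = - 1" by algebra
  have nu: "norm u = 1" using u by (simp add: cmod_def power2_eq_square)
  have g: "g z = of_real (Re z) * u + of_real (Im z) * f \<i> + g 0" for z
  proof -
    have "z = Re z *\<^sub>R 1 + Im z *\<^sub>R \<i>" by (simp add: complex_eq_iff)
    then have "f z = f (Re z *\<^sub>R 1 + Im z *\<^sub>R \<i>)" by simp
    also have "\<dots> = Re z *\<^sub>R u + Im z *\<^sub>R f \<i>"
      using lin by (simp add: linear_add linear_scale u_def)
    finally show ?thesis by (simp add: f_def scaleR_conv_of_real algebra_simps)
  qed
  from t show ?thesis
  proof
    assume "t = 1"
    then have "f \<i> = \<i> * u" using re im by (simp add: complex_eq_iff)
    then have "g z = u * z + g 0" for z by (subst g) (simp add: complex_eq_iff)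
    then have "g = (\<lambda>z. u * z + g 0)" by (rule ext)
    then show ?thesis using nu that(1) by blast
  next
    assume "t = - 1"
    then have "f \<i> = - \<i> * u" using re im by (simp add: complex_eq_iff)
    then have "g z = u * cnj z + g 0" for z by (subst g) (simp add: complex_eq_iff)
    then have "g = (\<lambda>z. u * cnj z + g 0)" by (rule ext)
    then show ?thesis using nu that(2) by blast
  qed
qed

text \<open>The axis direction \<open>s\<close> is a square root of \<open>u\<close>. The component of \<open>c\<close> along \<open>s\<close> is the glide,
  and the orthogonal component is twice the displacement of the axis from the origin.\<close>

lemma orientation_reversing_is_glide_reflection:
  assumes "norm u = 1"
  shows "\<exists>p s t. s \<noteq> 0 \<and> (\<lambda>z. u * cnj z + c) = glide_reflection p s t"
proof -
  define s where "s = csqrt u"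
  have s2: "s * s = u" by (simp add: s_def flip: power2_eq_square)
  then have "norm s * norm s = 1" using assms by (simp flip: norm_mult)
  then have ns: "norm s = 1" by (smt (verit) norm_ge_zero mult_cancel_right1 square_eq_1_iff)
  have sc: "s * cnj s = 1" using ns by (simp add: complex_norm_square[symmetric])
  have s0: "s \<noteq> 0" using ns by auto
  have inv: "1 / cnj s = s" using sc s0 by (simp add: field_simps)
  define y where "y = c / s"
  have c: "c = of_real (Re y) * s + of_real (Im y) * \<i> * s"
  proof -
    have "c = y * s" using s0 by (simp add: y_def)
    also have "y = of_real (Re y) + of_real (Im y) * \<i>" by (simp add: complex_eq_iff)
    finally show ?thesis by (simp add: algebra_simps)
  qed
  define p where "p = of_real (Im y / 2) * \<i> * s"
  have "glide_reflection p s (Re y) z = u * cnj z + c" for z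
  proof -
    have "s * cnj ((z - p) / s) = s * (cnj z - cnj p) * (1 / cnj s)" by simp
    also have "\<dots> = u * (cnj z - cnj p)" unfolding inv s2[symmetric] by simp
    finally have "glide_reflection p s (Re y) z = p + u * cnj z - u * cnj p + of_real (Re y) * s"
      by (simp add: glide_reflection_def reflection_def algebra_simps)
    moreover have "u * cnj p = - p"
    proof -
      have "u * cnj p = - (of_real (Im y / 2) * \<i> * s) * (s * cnj s)"
        by (simp add: p_def s2[symmetric])
      then show ?thesis by (simp add: sc p_def)
    qed
    moreover have "c = 2 * p + of_real (Re y) * s" by (subst c) (simp add: p_def)
    ultimately show ?thesis by simp
  qed
  then have "(\<lambda>z. u * cnj z + c) = glide_reflection p s (Re y)" by (intro ext) simp
  then show ?thesis using s0 by blast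
qed

lemma in_cell_iff:
  "z \<in> cell i j \<longleftrightarrow> Re z \<in> {of_int i..of_int i + 1} \<and> Im z \<in> {of_int j..of_int j + 1}"
  by (simp add: cell_def in_cbox_complex_iff)

lemma in_warp_iff: "z \<in> warp i \<longleftrightarrow> of_int i \<le> Re z \<and> Re z \<le> of_int i + 1"
  by (auto simp: warp_def in_cell_iff)
    (intro exI[of _ "\<lfloor>Im z\<rfloor>"], linarith)

lemma in_weft_iff: "z \<in> weft j \<longleftrightarrow> of_int j \<le> Im z \<and> Im z \<le> of_int j + 1"
  by (auto simp: weft_def in_cell_iff)
    (intro exI[of _ "\<lfloor>Re z\<rfloor>"], linarith)

lemma cell_eq_warp_Int_weft: "cell i j = warp i \<inter> weft j"
  by (auto simp: in_cell_iff in_warp_iff in_weft_iff)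

lemma warp_eq_iff [simp]: "warp i = warp k \<longleftrightarrow> i = k"
proof
  assume e: "warp i = warp k"
  have "Complex (of_int i) 0 \<in> warp i" "Complex (of_int k) 0 \<in> warp k"
    "Complex (of_int i + 1) 0 \<in> warp i" "Complex (of_int k + 1) 0 \<in> warp k"
    by (auto simp: in_warp_iff)
  then show "i = k" unfolding e unfolding e[symmetric] in_warp_iff by auto
qed auto

lemma cell_eq_iff [simp]: "cell i j = cell k l \<longleftrightarrow> i = k \<and> j = l"
proof
  assume e: "cell i j = cell k l"
  have "Complex (of_int i) (of_int j) \<in> cell i j" "Complex (of_int k) (of_int l) \<in> cell k l"
    by (auto simp: in_cell_iff)
  then have "Complex (of_int i) (of_int j) \<in> cell k l" "Complex (of_int k) (of_int l) \<in> cell i j"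
    using e by simp_all
  then show "i = k \<and> j = l" by (simp add: in_cell_iff)
qed auto

lemma warp_neq_weft [simp]: "warp i \<noteq> weft j" "weft j \<noteq> warp i"
proof -
  have "Complex (of_int i) (of_int j + 2) \<in> warp i" "Complex (of_int i) (of_int j + 2) \<notin> weft j"
    by (auto simp: in_warp_iff in_weft_iff)
  then show "warp i \<noteq> weft j" "weft j \<noteq> warp i" by blast+
qed

text \<open>Two points of a cell at distance \<open>sqrt 2\<close> must differ by the full side length in both
  coordinates. Since isometries preserve this distance, the images of opposite corners of a cell
  are again opposite corners.\<close>

lemma cell_diameter_ends:
  assumes "x \<in> cell k l" "y \<in> cell k l" "dist x y = sqrt 2"
  shows "x \<in> cell_corners" "y - x \<in> {1 + \<i>, 1 - \<i>, - 1 + \<i>, - 1 - \<i>}"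
proof -
  define a where "a = Re y - Re x"
  define b where "b = Im y - Im x"
  have ab: "\<bar>a\<bar> \<le> 1" "\<bar>b\<bar> \<le> 1" using assms by (auto simp: in_cell_iff a_def b_def)
  have "(dist x y)\<^sup>2 = a\<^sup>2 + b\<^sup>2"
    by (simp add: dist_norm cmod_power2 a_def b_def power2_commute)
  then have "a\<^sup>2 + b\<^sup>2 = 2" using assms(3) by simp
  moreover have "a\<^sup>2 \<le> 1" "b\<^sup>2 \<le> 1" using ab by (simp_all add: abs_square_le_1)
  ultimately have "a\<^sup>2 = 1" "b\<^sup>2 = 1" by linarith+
  then have ab1: "a = 1 \<or> a = - 1" "b = 1 \<or> b = - 1" by (simp_all add: power2_eq_1_iff)
  then show "y - x \<in> {1 + \<i>, 1 - \<i>, - 1 + \<i>, - 1 - \<i>}"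
    by (auto simp: complex_eq_iff a_def b_def)
  have "Re x = of_int k \<or> Re x = of_int k + 1" "Im x = of_int l \<or> Im x = of_int l + 1"
    using assms(1,2) ab1 by (auto simp: in_cell_iff a_def b_def)
  then show "x \<in> cell_corners" by (auto simp: cell_corners_iff)
qed

text \<open>The orientation-preserving symmetries of the tessellation, translations included.\<close>

definition cell_rotation :: "(complex \<Rightarrow> complex) \<Rightarrow> bool" where
  "cell_rotation g \<longleftrightarrow> (\<exists>u\<in>gauss_units. \<exists>c\<in>cell_corners. g = (\<lambda>z. u * z + c))"

lemma planar_group_iff: "g \<in> planar_group P \<longleftrightarrow> (\<exists>\<epsilon>. symmetry P g \<epsilon>)"
  by (force simp: planar_group_def symmetry_group_def)

text \<open>The diagonal from \<open>0\<close> to \<open>1 + \<i>\<close> is mapped to a diagonal of a cell, which shows that the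
  translation part is a Gaussian integer and the linear part is a Gaussian unit. The
  orientation-reversing case is ruled out by type \<open>p4\<close>.\<close>

lemma planar_group_cell_rotation:
  assumes "type_p4 (planar_group P)" "symmetry P g \<epsilon>"
  shows "cell_rotation g"
proof -
  have g: "g \<in> planar_group P" "plane_isometry g" "preserves_tessellation g"
    using assms(2) by (auto simp: planar_group_iff symmetry_def)
  show ?thesis using g(2)
  proof (cases rule: plane_isometry_cases)
    case (2 u c)
    then obtain p s t where "s \<noteq> 0" "g = glide_reflection p s t"
      using orientation_reversing_is_glide_reflection by metis
    then show ?thesis using assms(1) g(1) by (auto simp: type_p4_def)
  next
    case (1 u c)
    have "cell 0 0 \<in> cells" by (auto simp: cells_def)
    then have "g ` cell 0 0 \<in> cells" using g(3) by (auto simp: preserves_tessellation_def)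
    then obtain k l where kl: "g ` cell 0 0 = cell k l" by (auto simp: cells_def)
    have "g 0 \<in> cell k l" "g (1 + \<i>) \<in> cell k l"
      unfolding kl[symmetric] by (auto simp: in_cell_iff)
    moreover have "dist (g 0) (g (1 + \<i>)) = dist 0 (1 + \<i>)"
      using g(2) by (simp add: plane_isometry_def)
    then have "dist (g 0) (g (1 + \<i>)) = sqrt 2" by (simp add: cmod_def)
    ultimately have "g 0 \<in> cell_corners" "g (1 + \<i>) - g 0 \<in> {1 + \<i>, 1 - \<i>, - 1 + \<i>, - 1 - \<i>}"
      by (rule cell_diameter_ends)+
    then have c: "c \<in> cell_corners" and u: "u * (1 + \<i>) \<in> {1 + \<i>, 1 - \<i>, - 1 + \<i>, - 1 - \<i>}"
      using 1 by simp_all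
    have "u * 2 = (u * (1 + \<i>)) * (1 - \<i>)" by (simp add: complex_eq_iff)
    then have "u = (u * (1 + \<i>)) * (1 - \<i>) / 2" by (simp add: field_simps)
    with u have "u \<in> gauss_units" by (auto simp: gauss_units_def complex_eq_iff)
    then show ?thesis using c 1 unfolding cell_rotation_def by blast
  qed
qed

lemma cell_rotation_bij: assumes "cell_rotation g" shows "bij g"
proof -
  obtain u c where g: "u \<in> gauss_units" "g = (\<lambda>z. u * z + c)"
    using assms by (auto simp: cell_rotation_def)
  obtain u' where "u * u' = 1" using gauss_units_inverse[OF g(1)] by blast
  then show ?thesis unfolding g(2)
    by (intro bij_betw_byWitness[of _ "\<lambda>z. u' * (z - c)"])
      (auto simp: algebra_simps simp flip: mult.assoc)
qed

lemma image_eq_of_iff: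
  assumes "bij g" "\<And>z. g z \<in> B \<longleftrightarrow> z \<in> A" shows "g ` A = B"
proof (intro equalityI subsetI)
  fix w assume "w \<in> B"
  moreover obtain z where "w = g z" using bij_is_surj[OF assms(1)] by (rule surjE)
  ultimately show "w \<in> g ` A" using assms(2) by blast
qed (use assms(2) in blast)

text \<open>The action on the two strands at a cell, not just on the cell, is what makes the side-reversals
  of symmetries compose: the lowermost strand is carried along correctly because it is the other
  one of two.\<close>

lemma cell_rotation_strands:
  assumes "cell_rotation g" "g ` cell i j = cell k l"
  shows "g ` warp i = warp k \<and> g ` weft j = weft l \<or> g ` warp i = weft l \<and> g ` weft j = warp k"
proof -
  obtain u c where u: "u \<in> gauss_units" and "c \<in> cell_corners" and g: "g = (\<lambda>z. u * z + c)"
    using assms by (auto simp: cell_rotation_def)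
  then obtain a b :: int where c: "c = Complex (of_int a) (of_int b)"
    by (auto simp: cell_corners_def)
  have bij: "bij g" by (rule cell_rotation_bij[OF assms(1)])
  have int: "g ` cell i j = g ` warp i \<inter> g ` weft j"
    unfolding cell_eq_warp_Int_weft using bij by (metis image_Int bij_is_inj)
  note img = image_eq_of_iff[OF bij]
  have "\<exists>k l. g ` warp i = warp k \<and> g ` weft j = weft l \<or> g ` warp i = weft l \<and> g ` weft j = warp k"
    using u unfolding gauss_units_def
  proof (elim insertE emptyE)
    assume u: "u = 1"
    have "g ` warp i = warp (i + a)" "g ` weft j = weft (j + b)"
      by (rule img; auto simp: g c u in_warp_iff in_weft_iff)+
    then show ?thesis by blast
  next
    assume u: "u = - 1"
    have "g ` warp i = warp (a - 1 - i)" "g ` weft j = weft (b - 1 - j)"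
      by (rule img; auto simp: g c u in_warp_iff in_weft_iff)+
    then show ?thesis by blast
  next
    assume u: "u = \<i>"
    have "g ` warp i = weft (b + i)" "g ` weft j = warp (a - 1 - j)"
      by (rule img; auto simp: g c u in_warp_iff in_weft_iff)+
    then show ?thesis by blast
  next
    assume u: "u = - \<i>"
    have "g ` warp i = weft (b - 1 - i)" "g ` weft j = warp (a + j)"
      by (rule img; auto simp: g c u in_warp_iff in_weft_iff)+
    then show ?thesis by blast
  qed
  then obtain k' l' where kl: "g ` warp i = warp k' \<and> g ` weft j = weft l' \<or>
      g ` warp i = weft l' \<and> g ` weft j = warp k'" by blast
  then have "g ` cell i j = cell k' l'" unfolding int cell_eq_warp_Int_weft[of k' l'] by auto
  then have "k' = k" "l' = l" using assms(2) by auto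
  then show ?thesis using kl by simp
qed

definition facing :: "side_action \<Rightarrow> prefabric \<Rightarrow> int \<Rightarrow> int \<Rightarrow> complex set" where
  "facing \<epsilon> P i j = (case \<epsilon> of Keep \<Rightarrow> uppermost P i j | Reverse \<Rightarrow> lowermost P i j)"

text \<open>The group operation on \<open>{Keep, Reverse}\<close>.\<close>

definition then_side :: "side_action \<Rightarrow> side_action \<Rightarrow> side_action" where
  "then_side \<delta> \<epsilon> = (if \<delta> = \<epsilon> then Keep else Reverse)"

lemma symmetry_facing:
  assumes "cell_rotation g" "symmetry P g \<epsilon>" "g ` cell i j = cell k l"
  shows "g ` facing \<delta> P i j = facing (then_side \<delta> \<epsilon>) P k l"
proof -
  have "g ` uppermost P i j = facing \<epsilon> P k l"
    using assms(2,3) by (simp add: symmetry_def facing_def)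
  then show ?thesis using cell_rotation_strands[OF assms(1,3)]
    by (cases \<delta>; cases \<epsilon>)
      (auto simp: facing_def then_side_def uppermost_def lowermost_def split: if_splits)
qed

lemma symmetryI:
  assumes "plane_isometry g" "preserves_tessellation g"
    and "\<And>i j k l. g ` cell i j = cell k l \<Longrightarrow> g ` facing Keep P i j = facing \<epsilon> P k l"
  shows "symmetry P g \<epsilon>"
  using assms by (simp add: symmetry_def facing_def)

lemma preserves_tessellation_cell:
  assumes "preserves_tessellation g" obtains k l where "g ` cell i j = cell k l"
proof -
  have "cell i j \<in> cells" by (auto simp: cells_def)
  then have "g ` cell i j \<in> cells" using assms by (auto simp: preserves_tessellation_def)
  then show ?thesis using that by (auto simp: cells_def)
qed

lemma symmetry_compose:
  assumes "cell_rotation g" "symmetry P g \<epsilon>" "cell_rotation h" "symmetry P h \<delta>"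
  shows "symmetry P (\<lambda>z. g (h z)) (then_side \<delta> \<epsilon>)"
proof (rule symmetryI)
  have g: "plane_isometry g" "preserves_tessellation g"
    and h: "plane_isometry h" "preserves_tessellation h" using assms by (auto simp: symmetry_def)
  show "plane_isometry (\<lambda>z. g (h z))"
    using g h bij_comp[of h g] by (auto simp: plane_isometry_def comp_def)
  have "(\<lambda>c. (\<lambda>z. g (h z)) ` c) ` cells = (\<lambda>c. g ` c) ` (\<lambda>c. h ` c) ` cells"
    by (simp add: image_image)
  then show "preserves_tessellation (\<lambda>z. g (h z))"
    using g h by (simp add: preserves_tessellation_def)
  fix i j k l assume kl: "(\<lambda>z. g (h z)) ` cell i j = cell k l"
  obtain m n where mn: "h ` cell i j = cell m n" using h(2) by (rule preserves_tessellation_cell)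
  have "g ` cell m n = cell k l" using kl by (simp add: mn[symmetric] image_image)
  from symmetry_facing[OF assms(1,2) this, of \<delta>] symmetry_facing[OF assms(3,4) mn, of Keep]
  show "(\<lambda>z. g (h z)) ` facing Keep P i j = facing (then_side \<delta> \<epsilon>) P k l"
    by (cases \<delta>) (simp_all add: image_image[symmetric] then_side_def)
qed

lemma symmetry_inverse:
  assumes "cell_rotation g" "symmetry P g \<epsilon>" and inv: "\<And>z. g (h z) = z" "\<And>z. h (g z) = z"
  shows "symmetry P h \<epsilon>"
proof (rule symmetryI)
  have g: "plane_isometry g" "preserves_tessellation g" using assms by (auto simp: symmetry_def)
  have "bij h" using inv by (metis bijI')
  moreover have "dist (h x) (h y) = dist x y" for x y
    using g(1) inv unfolding plane_isometry_def by metis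
  ultimately show "plane_isometry h" by (simp add: plane_isometry_def)
  have hg: "h ` g ` S = S" and gh: "g ` h ` S = S" for S by (simp_all add: image_image inv)
  have "(\<lambda>c. h ` c) ` cells = (\<lambda>c. h ` c) ` (\<lambda>c. g ` c) ` cells"
    using g(2) by (simp add: preserves_tessellation_def)
  then show "preserves_tessellation h" by (simp add: preserves_tessellation_def image_image inv)
  fix i j k l assume kl: "h ` cell i j = cell k l"
  then have "g ` cell k l = cell i j" using gh by metis
  from symmetry_facing[OF assms(1,2) this, of \<epsilon>]
  have "g ` facing \<epsilon> P k l = facing Keep P i j" by (simp add: then_side_def)
  then show "h ` facing Keep P i j = facing \<epsilon> P k l" using hg by metis
qed


section \<open>Isonemal prefabrics of type p4\<close>

text \<open>With reflections and glide-reflections excluded, every element of \<open>H\<close> is \<open>z \<mapsto> u * z + c\<close>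
  with a Gaussian unit \<open>u\<close> and a Gaussian integer \<open>c\<close>, so that computations in the group
  become arithmetic of Gaussian integers.\<close>

locale p4_prefabric =
  fixes P :: prefabric
  assumes p4: "type_p4 (planar_group P)"
begin

abbreviation "H \<equiv> planar_group P"
abbreviation "\<Lambda> \<equiv> translation_vectors H"

lemma compose:
  assumes "symmetry P g \<epsilon>" "symmetry P h \<delta>"
  shows "symmetry P (\<lambda>z. g (h z)) (then_side \<delta> \<epsilon>)"
  using symmetry_compose planar_group_cell_rotation[OF p4] assms by blast

lemma inverse:
  assumes "symmetry P g \<epsilon>" "\<And>z. g (h z) = z" "\<And>z. h (g z) = z"
  shows "symmetry P h \<epsilon>"
  using symmetry_inverse planar_group_cell_rotation[OF p4] assms by blast

lemma planar_compose: "g \<in> H \<Longrightarrow> h \<in> H \<Longrightarrow> (\<lambda>z. g (h z)) \<in> H"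
  using compose by (metis planar_group_iff)

lemma planar_inverse:
  "g \<in> H \<Longrightarrow> (\<And>z. g (h z) = z) \<Longrightarrow> (\<And>z. h (g z) = z) \<Longrightarrow> h \<in> H"
  using inverse by (metis planar_group_iff)

lemma planar_rotation:
  assumes "g \<in> H" obtains u c where "u \<in> gauss_units" "c \<in> cell_corners" "g = (\<lambda>z. u * z + c)"
  using assms planar_group_cell_rotation[OF p4] unfolding planar_group_iff cell_rotation_def
  by metis

lemma rotation_parts:
  assumes "(\<lambda>z. u * z + c) \<in> H" shows "c \<in> cell_corners"
proof -
  obtain u' c' where c': "c' \<in> cell_corners" and e: "(\<lambda>z. u * z + c) = (\<lambda>z. u' * z + c')"
    using planar_rotation[OF assms] by metis
  show ?thesis using c' fun_cong[OF e, of 0] by simp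
qed

lemma same_linear_part:
  assumes "(\<lambda>z. u * z + b) \<in> H" "(\<lambda>z. u * z + c) \<in> H" "u \<in> gauss_units"
  shows "c - b \<in> \<Lambda>"
proof -
  obtain u' where u': "u * u' = 1" "u' * u = 1" using gauss_units_inverse[OF assms(3)] by blast
  have "(\<lambda>z. u' * (z - b)) \<in> H"
    by (rule planar_inverse[OF assms(1)])
      (simp_all add: u' algebra_simps flip: mult.assoc)
  from planar_compose[OF assms(2) this] have "(\<lambda>z. u * (u' * (z - b)) + c) \<in> H" .
  then have "(\<lambda>z. z + (c - b)) \<in> H"
    by (simp add: u' algebra_simps flip: mult.assoc)
  then show ?thesis by (simp add: translation_vectors_def)
qed

lemma translation_diff:
  assumes "v \<in> \<Lambda>" "w \<in> \<Lambda>" shows "v - w \<in> \<Lambda>"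
  using assms same_linear_part[of 1 w v] by (simp add: translation_vectors_def gauss_units_def)

lemma quarter_turn:
  "p \<in> quarter_turn_centres H \<longleftrightarrow> (\<lambda>z. \<i> * z + (1 - \<i>) * p) \<in> H"
  by (simp add: quarter_turn_centres_def algebra_simps)

lemma obtain_quarter_turn: obtains p where "p \<in> quarter_turn_centres H"
  using p4 by (auto simp: type_p4_def)

text \<open>Conjugating a translation by a quarter-turn rotates its vector; the side action of the
  quarter-turn, whichever it is, occurs twice and cancels.\<close>

lemma translation_rotate:
  assumes "symmetry P (\<lambda>z. z + v) \<epsilon>" shows "symmetry P (\<lambda>z. z + \<i> * v) \<epsilon>"
proof -
  obtain p where p: "p \<in> quarter_turn_centres H" by (rule obtain_quarter_turn)
  define b where "b = (1 - \<i>) * p"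
  obtain \<delta> where r: "symmetry P (\<lambda>z. \<i> * z + b) \<delta>"
    using p unfolding quarter_turn planar_group_iff b_def by blast
  have r': "symmetry P (\<lambda>z. - \<i> * (z - b)) \<delta>"
    by (rule inverse[OF r]) (simp_all add: algebra_simps flip: mult.assoc)
  have "(\<lambda>z. \<i> * (- \<i> * (z - b) + v) + b) = (\<lambda>z. z + \<i> * v)"
    by (rule ext) (simp add: algebra_simps flip: mult.assoc)
  moreover have "then_side (then_side \<delta> \<epsilon>) \<delta> = \<epsilon>" by (cases \<delta>; cases \<epsilon>) (auto simp: then_side_def)
  ultimately show ?thesis using compose[OF r compose[OF assms r']] by simp
qed

text \<open>Closure under multiplication by \<open>\<i>\<close> makes the translation vectors an ideal of the Gaussian
  integers.\<close>

lemma translation_lattice: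
  obtains w where "w \<in> cell_corners" "w \<noteq> 0" "\<Lambda> = {q * w | q. q \<in> cell_corners}"
proof -
  have sub: "\<Lambda> \<subseteq> cell_corners"
    using rotation_parts[of 1] by (auto simp: translation_vectors_def)
  obtain u v where uv: "u \<in> \<Lambda>" "v \<in> \<Lambda>" "u \<noteq> v" using p4 by (auto simp: type_p4_def)
  have "\<exists>w. w \<noteq> 0 \<and> \<Lambda> = {q * w | q. q \<in> cell_corners}"
  proof (rule gauss_ideal_principal[OF sub translation_diff])
    show "\<i> * v \<in> \<Lambda>" if "v \<in> \<Lambda>" for v
      using that translation_rotate by (auto simp: translation_vectors_def planar_group_iff)
    show "\<exists>v\<in>\<Lambda>. v \<noteq> 0" using uv by metis
  qed
  then obtain w where w: "w \<noteq> 0" and L: "\<Lambda> = {q * w | q. q \<in> cell_corners}" by blast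
  have "1 * w \<in> \<Lambda>" unfolding L by (auto simp: cell_corners_iff intro!: exI[of _ 1])
  then show ?thesis using that sub w L by auto
qed

text \<open>Composing a quarter-turn with the translation by \<open>(1 - \<i>) * v\<close> moves its centre by \<open>v\<close>, so
  all translates of one centre are centres.\<close>

lemma lattice_unit_square:
  assumes w: "w \<noteq> 0" and L: "\<Lambda> = {q * w | q. q \<in> cell_corners}"
    and p: "p \<in> quarter_turn_centres H"
  shows "lattice_unit H (square p w)"
proof -
  have lattice: "\<Lambda> = {of_int a * w + of_int b * (\<i> * w) | a b. True}"
  proof -
    have "Complex (of_int a) (of_int b) * w = of_int a * w + of_int b * (\<i> * w)" for a b
      by (simp add: complex_eq_iff algebra_simps)
    then show ?thesis unfolding L cell_corners_def by (auto; metis)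
  qed
  have shift: "p + q * w \<in> quarter_turn_centres H" if q: "q \<in> cell_corners" for q
  proof -
    have "(1 - \<i>) * q \<in> cell_corners"
      using q by (intro cell_corners_mult) (simp_all add: cell_corners_iff)
    then have "((1 - \<i>) * q) * w \<in> \<Lambda>" unfolding L by blast
    then have "(\<lambda>z. z + (1 - \<i>) * q * w) \<in> H" by (simp add: translation_vectors_def)
    from planar_compose[OF this p[unfolded quarter_turn]]
    show ?thesis unfolding quarter_turn by (simp add: algebra_simps)
  qed
  have "square p w \<subseteq> quarter_turn_centres H"
    using shift[of 0] shift[of 1] shift[of "1 + \<i>"] shift[of \<i>]
    by (simp add: square_def cell_corners_iff algebra_simps)
  then show ?thesis using w lattice unfolding lattice_unit_def by blast
qed

text \<open>The translations by \<open>v\<close> and \<open>\<i> * v\<close> have the same side action, so it cancels in their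
  composition.\<close>

lemma double_translation_keeps:
  assumes "v \<in> \<Lambda>" shows "symmetry P (\<lambda>z. z + (1 + \<i>) * v) Keep"
proof -
  obtain \<epsilon> where e: "symmetry P (\<lambda>z. z + v) \<epsilon>"
    using assms by (auto simp: translation_vectors_def planar_group_iff)
  from compose[OF e translation_rotate[OF e]] show ?thesis
    by (simp add: then_side_def algebra_simps)
qed

lemma keep_translation_period:
  fixes a b :: int
  assumes "symmetry P (\<lambda>z. z + Complex (of_int a) (of_int b)) Keep"
  shows "P (i + a) (j + b) = P i j"
proof -
  let ?g = "\<lambda>z. z + Complex (of_int a) (of_int b)"
  have bij: "bij ?g" using assms by (simp add: symmetry_def plane_isometry_def)
  have warp: "?g ` warp i = warp (i + a)" and weft: "?g ` weft j = weft (j + b)"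
    by (rule image_eq_of_iff[OF bij]; auto simp: in_warp_iff in_weft_iff)+
  have "?g ` cell i j = cell (i + a) (j + b)"
    by (rule image_eq_of_iff[OF bij]) (auto simp: in_cell_iff)
  then have "?g ` uppermost P i j = uppermost P (i + a) (j + b)"
    using assms by (simp add: symmetry_def)
  then show ?thesis by (auto simp: uppermost_def warp weft split: if_splits)
qed

lemma order_le_4:
  assumes w: "w \<in> \<Lambda>" and dvd: "4 = (1 + \<i>) * w"
  shows "prefabric_order P \<le> 4"
proof -
  have "symmetry P (\<lambda>z. z + 4) Keep" unfolding dvd by (rule double_translation_keeps[OF w])
  moreover from translation_rotate[OF this] have "symmetry P (\<lambda>z. z + \<i> * 4) Keep" .
  moreover have "4 = Complex (of_int 4) (of_int 0)" "\<i> * 4 = Complex (of_int 0) (of_int 4)"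
    by (simp_all add: complex_eq_iff)
  ultimately have "P (i + 4) (j + 0) = P i j" "P (i + 0) (j + 4) = P i j" for i j
    using keep_translation_period by metis+
  then have "repeats_every P 4" by (simp add: repeats_every_def)
  then show ?thesis unfolding prefabric_order_def by (intro Least_le) simp
qed

text \<open>Translations and half-turns act on the indices of the warps as \<open>i \<mapsto> i + a\<close> and
  \<open>i \<mapsto> b - i\<close>, where all \<open>a\<close> are multiples of \<open>d\<close> and all \<open>b\<close> are congruent modulo \<open>d\<close>. So the
  orbit of warp \<open>0\<close> meets at most two residue classes modulo \<open>d\<close>, while transitivity requires
  all of them.\<close>

lemma divisor_le_2:
  assumes iso: "isonemal P"
    and dvd: "\<And>v. v \<in> \<Lambda> \<Longrightarrow> \<exists>k::int. Re v = of_int (k * d)"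
  shows "\<bar>d\<bar> \<le> 2"
proof (rule ccontr)
  assume d: "\<not> \<bar>d\<bar> \<le> 2"
  \<comment> \<open>\<open>1\<close> and \<open>2\<close> are not multiples of \<open>d\<close>, so only half-turns can take warp \<open>0\<close> there\<close>
  have half_turn: "\<exists>c. Re c = of_int j + 1 \<and> (\<lambda>z. - 1 * z + c) \<in> H" if j: "j = 1 \<or> j = 2" for j
  proof -
    have "warp 0 \<in> strands" "warp j \<in> strands" by (simp_all add: strands_def)
    with iso have "\<exists>(g, \<epsilon>)\<in>symmetry_group P. g ` warp 0 = warp j"
      unfolding isonemal_def by (metis (no_types))
    then obtain g \<epsilon> where g\<epsilon>: "(g, \<epsilon>) \<in> symmetry_group P" and gw: "g ` warp 0 = warp j"
      by auto
    have gH: "g \<in> H" unfolding planar_group_def using imageI[OF g\<epsilon>, of fst] by simp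
    obtain u c where u: "u \<in> gauss_units" and "c \<in> cell_corners" and g: "g = (\<lambda>z. u * z + c)"
      using planar_rotation[OF gH] .
    obtain a b :: int where c: "c = Complex (of_int a) (of_int b)"
      using \<open>c \<in> cell_corners\<close> by (auto simp: cell_corners_def)
    have mem: "g z \<in> warp j" if "z \<in> warp 0" for z using gw that by blast
    \<comment> \<open>the image of \<open>3 * \<i>\<close> would leave \<open>warp j\<close> under a quarter-turn; the images of \<open>0\<close> and \<open>1\<close>
      then determine the index\<close>
    have "0 \<in> warp 0" "1 \<in> warp 0" "3 * \<i> \<in> warp 0" by (auto simp: in_warp_iff)
    note m = this[THEN mem, unfolded g in_warp_iff c]
    have "u \<noteq> \<i>" "u \<noteq> - \<i>" using m(1,3) by auto
    moreover have "u \<noteq> 1"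
    proof
      assume 1: "u = 1"
      then have "c \<in> \<Lambda>" using gH by (simp add: g translation_vectors_def)
      then obtain k :: int where "Re c = of_int (k * d)" using dvd by blast
      then have "a = k * d" unfolding c complex.sel of_int_eq_iff .
      moreover have "a = j" using m(1,2) 1 by simp
      ultimately have "d dvd j" by simp
      then show False using d j zdvd_imp_le[of "\<bar>d\<bar>" j] by auto
    qed
    ultimately have u: "u = - 1" using u by (auto simp: gauss_units_def)
    then have "a = j + 1" using m(1,2) by simp
    then show ?thesis using gH unfolding g u c by (intro exI[of _ c]) (simp add: c)
  qed
  obtain b c where b: "Re b = 2" "(\<lambda>z. - 1 * z + b) \<in> H" and c: "Re c = 3" "(\<lambda>z. - 1 * z + c) \<in> H"
    using half_turn[of 1] half_turn[of 2] by auto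
  then have "c - b \<in> \<Lambda>" using same_linear_part[OF b(2) c(2)] by (simp add: gauss_units_def)
  then obtain k :: int where "Re (c - b) = of_int (k * d)" using dvd by blast
  then have "of_int (k * d) = (1 :: real)" by (simp add: b c)
  then have "k * d = 1" by linarith
  then have "\<bar>d * k\<bar> = 1" by (simp add: mult.commute)
  then have "\<bar>d\<bar> = 1" by (rule abs_zmult_eq_1)
  then show False using d by simp
qed

text \<open>Both \<open>m\<close> and, if \<open>n \<ge> 4\<close>, the number \<open>4 = - (1 + \<i>) ^ 4\<close> divide every translation vector.
  By the bound on such divisors the lattice is generated by \<open>(1 + \<i>) ^ n\<close> with \<open>n \<le> 3\<close>. It
  is then so dense that translations by \<open>4\<close> along the axes are symmetries that keep the sides.\<close>

lemma generator_not_axis_parallel: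
  assumes iso: "isonemal P" and order: "prefabric_order P > 4"
    and L: "\<Lambda> = {q * ((1 + \<i>) ^ n * of_int m) | q. q \<in> cell_corners}"
    and m: "m > 0" "odd m"
  shows False
proof -
  have pow: "(1 + \<i>) ^ n \<in> cell_corners" for n
    by (induction n) (auto intro!: cell_corners_mult simp: cell_corners_iff)
  have bound: "\<bar>d\<bar> \<le> 2" if d: "\<And>q. q \<in> cell_corners \<Longrightarrow>
      \<exists>r\<in>cell_corners. q * ((1 + \<i>) ^ n * of_int m) = r * of_int d" for d :: int
  proof (rule divisor_le_2[OF iso])
    fix v assume "v \<in> \<Lambda>"
    then obtain q where "q \<in> cell_corners" "v = q * ((1 + \<i>) ^ n * of_int m)" unfolding L by blast
    with d obtain r where r: "r \<in> cell_corners" "v = r * of_int d" by metis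
    then obtain a b :: int where "r = Complex (of_int a) (of_int b)"
      by (auto simp: cell_corners_def)
    then have "Re v = of_int (a * d)" using r by simp
    then show "\<exists>k::int. Re v = of_int (k * d)" by blast
  qed
  have "\<bar>m\<bar> \<le> 2"
  proof (rule bound)
    fix q assume "q \<in> cell_corners"
    then show "\<exists>r\<in>cell_corners. q * ((1 + \<i>) ^ n * of_int m) = r * of_int m"
      using pow cell_corners_mult by (intro bexI[of _ "q * (1 + \<i>) ^ n"]) auto
  qed
  then have m1: "m = 1" using m by presburger
  have four: "(1 + \<i>) ^ 4 = - 4" by (simp add: eval_nat_numeral complex_eq_iff)
  have "n < 4"
  proof (rule ccontr)
    assume "\<not> n < 4"
    then have "(1 + \<i>) ^ n = (1 + \<i>) ^ 4 * (1 + \<i>) ^ (n - 4)" by (simp flip: power_add)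
    then have n4: "(1 + \<i>) ^ n = - 4 * (1 + \<i>) ^ (n - 4)" by (simp only: four)
    have "\<bar>4 :: int\<bar> \<le> 2"
    proof (rule bound)
      fix q assume q: "q \<in> cell_corners"
      show "\<exists>r\<in>cell_corners. q * ((1 + \<i>) ^ n * of_int m) = r * of_int 4"
      proof (rule bexI)
        show "- (q * (1 + \<i>) ^ (n - 4)) \<in> cell_corners"
          using q pow cell_corners_mult cell_corners_minus by blast
      qed (simp add: m1 n4)
    qed
    then show False by simp
  qed
  \<comment> \<open>so \<open>4 = - (1 + \<i>) ^ 4\<close> is \<open>1 + \<i>\<close> times a translation vector\<close>
  then have "(1 + \<i>) ^ 4 = (1 + \<i>) ^ Suc (n + (3 - n))" by simp
  also have "\<dots> = (1 + \<i>) * ((1 + \<i>) ^ (3 - n) * (1 + \<i>) ^ n)"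
    by (simp only: power_Suc power_add mult.commute[of "(1 + \<i>) ^ n"])
  finally have "4 = (1 + \<i>) * ((- ((1 + \<i>) ^ (3 - n))) * (1 + \<i>) ^ n)" using four by simp
  moreover have "(- ((1 + \<i>) ^ (3 - n))) * (1 + \<i>) ^ n \<in> \<Lambda>"
    unfolding L m1 of_int_1 mult_1_right using cell_corners_minus[OF pow] by blast
  ultimately have "prefabric_order P \<le> 4" using order_le_4 by metis
  then show False using order by simp
qed

end

theorem theorem4:
  fixes P :: prefabric
  assumes "isonemal P"
    and "prefabric_order P > 4"
    and "type_p4 (planar_group P)"
  shows "\<exists>Q. lattice_unit (planar_group P) Q \<and>
    ((\<exists>n\<ge>1. unit_of_level n Q) \<or>
     (\<exists>Q'. (\<exists>n\<ge>1. unit_of_level n Q') \<and> forbidden_reflection Q Q'))"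
proof -
  interpret p4_prefabric P by unfold_locales (rule assms(3))
  obtain p where p: "p \<in> quarter_turn_centres H" by (rule obtain_quarter_turn)
  obtain w0 where w0: "w0 \<in> cell_corners" "w0 \<noteq> 0" and L0: "\<Lambda> = {q * w0 | q. q \<in> cell_corners}"
    by (rule translation_lattice)
  obtain n and M0 N0 :: int where odd0: "odd (M0 + N0)"
    and w0_eq: "w0 = (1 + \<i>) ^ n * Complex (of_int M0) (of_int N0)"
    using gauss_factor_one_plus_i[OF w0] by blast
  have "M0 \<noteq> 0 \<or> N0 \<noteq> 0" using odd0 by auto
  from gauss_unit_first_quadrant[OF this] odd0 obtain u and M N :: int where u: "u \<in> gauss_units"
    and MN: "M > 0" "N \<ge> 0" "odd (M + N)"
    and uMN: "u * Complex (of_int M0) (of_int N0) = Complex (of_int M) (of_int N)" by metis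
  \<comment> \<open>changing the generator by a unit brings its odd part into the first quadrant\<close>
  define w where "w = (1 + \<i>) ^ n * Complex (of_int M) (of_int N)"
  have w: "w = u * w0" unfolding w_def w0_eq uMN[symmetric] by (simp add: mult_ac)
  obtain u' where u': "u' \<in> gauss_units" "u * u' = 1" "u' * u = 1"
    using gauss_units_inverse[OF u] by blast
  then have "w \<noteq> 0" unfolding w using w0 by auto
  have L: "\<Lambda> = {q * w | q. q \<in> cell_corners}"
  proof (intro equalityI subsetI)
    fix v assume "v \<in> \<Lambda>"
    then obtain q where "q \<in> cell_corners" "v = q * w0" using L0 by blast
    then have "q * u' \<in> cell_corners" "v = (q * u') * w"
      using u' by (simp_all add: w mult.assoc cell_corners_mult gauss_units_corners)
    then show "v \<in> {q * w | q. q \<in> cell_corners}" by blast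
  next
    fix v assume "v \<in> {q * w | q. q \<in> cell_corners}"
    then obtain q where "q \<in> cell_corners" "v = (q * u) * w0" by (auto simp: w)
    then show "v \<in> \<Lambda>" unfolding L0 using u cell_corners_mult gauss_units_corners by blast
  qed
  have N: "N > 0"
  proof (rule ccontr)
    assume "\<not> N > 0"
    then have "N = 0" using MN(2) by simp
    moreover have "Complex (of_int M) 0 = of_int M" by (simp add: complex_eq_iff)
    ultimately have "odd M" and "w = (1 + \<i>) ^ n * of_int M" using MN(3) by (simp_all add: w_def)
    then show False
      using generator_not_axis_parallel[OF assms(1,2) _ MN(1), of n] L by simp
  qed
  define c where "c = p + (1 + \<i>) / 2 * w"
  have c: "(1 - \<i>) * c \<in> cell_corners"
  proof -
    have "(1 - \<i>) * c = (1 - \<i>) * p + w" by (simp add: c_def complex_eq_iff field_simps)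
    moreover have "(1 - \<i>) * p \<in> cell_corners" 
      by (rule rotation_parts[OF p[unfolded quarter_turn]])
    moreover have "w \<in> cell_corners"
      unfolding w
      using u w0 by (simp add: cell_corners_mult gauss_units_corners)
    ultimately show ?thesis by (simp add: cell_corners_add)
  qed
  define h where "h a b = (1 + \<i>) ^ n * ((1 + \<i>) / 2 * Complex (of_int a) (of_int b))" for a b :: int
  have sq: "square p w = centred_square c (h M N)"
    by (simp add: square_eq_centred_square c_def h_def w_def mult_ac)
  have unit: "lattice_unit H (centred_square c (h M N))"
    using lattice_unit_square[OF \<open>w \<noteq> 0\<close> L p] by (simp add: sq)
  have level: "unit_of_level (Suc n) (centred_square c (h a b))" if "a > b" "b > 0" "odd (a + b)" for a b
    unfolding h_def by (rule unit_of_level_centred_square[OF that c refl])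
  have "M \<noteq> N" using MN(3) by auto
  then consider "M > N" | "N > M" by linarith
  then show ?thesis
  proof cases
    case 1
    then have "unit_of_level (Suc n) (centred_square c (h M N))" using level N MN(3) by blast
    then have "\<exists>n\<ge>1. unit_of_level n (centred_square c (h M N))" by (intro exI[of _ "Suc n"]) simp
    then show ?thesis using unit by blast
  next
    case 2
    have "1 + \<i> \<noteq> 0" "Complex (of_int N) (of_int M) \<noteq> 0" using N by (simp_all add: complex_eq_iff)
    then have "h N M \<noteq> 0" by (simp add: h_def)
    \<comment> \<open>the reflection in the horizontal line through the centre exchanges \<open>M\<close> and \<open>N\<close>\<close>
    have "reflection c 1 ` centred_square c (h N M) = centred_square c (h M N)"
      using cnj_half_diagonal[of n "of_int N" "of_int M"] unfolding reflection_centred_square h_def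
      by (metis centred_square_unit)
    then have "forbidden_reflection (centred_square c (h M N)) (centred_square c (h N M))"
      unfolding forbidden_reflection_def forbidden_directions_def
      using square_centre_centred_square[OF \<open>h N M \<noteq> 0\<close>] by (intro bexI[of _ 1]) simp_all
    moreover have "unit_of_level (Suc n) (centred_square c (h N M))"
      using level 2 MN by (simp add: add.commute)
    then have "\<exists>n\<ge>1. unit_of_level n (centred_square c (h N M))" by (intro exI[of _ "Suc n"]) simp
    ultimately show ?thesis using unit by blast
  qed
qed

end
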